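(* For every integer $n\geq 1$, the number of restricted colored base-$3$ partitions of $\frac{1}{2}(3^n-3)$ is $2^{n-1}(2^n-1)$. In particular, if $n$ is a prime number such that $2^n-1$ is also prime, then the number of such partitions is a perfect number. Conversely, every even perfect number can be expressed in this way, i.e., it equals the number of restricted colored base-$3$ partitions of $\frac{1}{2}(3^n-3)$ for some prime $n$ such that $2^n-1$ is prime.
   Context: A restricted colored base-$3$ partition of an integer $m\geq 0$ is a way of writing $m$ as a sum of powers of $3$ (with $3^0=1$ allowed; the order of the summands is irrelevant), where each part is either overlined, marked by a tilde, or unmarked (no part carries both marks), such that for every power $3^j$: at most one copy of $3^j$ is overlined, at most one copy of $3^j$ is marked by a tilde, and at most two copies of $3^j$ are unmarked. The integer $0$ has exactly one such partition, the empty one. A perfect number is a positive integer equal to the sum of its proper positive divisors. *)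

theory Defs
  imports Complex_Main "HOL-Library.Multiset" "HOL-Computational_Algebra.Primes"
begin

datatype mark = Unmarked | Overlined | Tilde

text \<open>A part is a pair of its size (a positive integer) and its mark; since the order of the
  summands is irrelevant, a partition is a multiset of parts.\<close>

definition is_restricted_colored_base3_partition :: "(nat \<times> mark) multiset \<Rightarrow> nat \<Rightarrow> bool" where
  "is_restricted_colored_base3_partition P m \<longleftrightarrow>
     (\<forall>p \<in># P. \<exists>j. fst p = 3 ^ j) \<and>
     (\<forall>j. count P (3 ^ j, Overlined) \<le> 1 \<and>
          count P (3 ^ j, Tilde) \<le> 1 \<and>
          count P (3 ^ j, Unmarked) \<le> 2) \<and>
     (\<Sum>p\<in>#P. fst p) = m"

definition num_restricted_colored_base3_partitions :: "nat \<Rightarrow> nat" where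
  "num_restricted_colored_base3_partitions m =
     card {P. is_restricted_colored_base3_partition P m}"

definition perfect_number :: "nat \<Rightarrow> bool" where
  "perfect_number N \<longleftrightarrow> N > 0 \<and> \<Sum>{d. d dvd N \<and> d < N} = N"

end

theory Submission
  imports Defs
begin

text \<open>
  Let \<open>c m\<close> be the number of restricted colored base-3 partitions of \<open>m\<close>. Each power
  \<open>3 ^ j\<close> contributes to the generating function of \<open>c\<close> the factor
  \<open>(1 + x)\<^sup>2 (1 + x + x\<^sup>2) = 1 + 3 x + 4 x\<^sup>2 + 3 x^3 + x^4\<close>, where \<open>x = q ^ (3 ^ j)\<close>.
  Combinatorially, a partition consists of its parts of size \<open>1\<close> and of a remainder, all of whose
  parts are divisible by \<open>3\<close>; dividing these by \<open>3\<close> gives an arbitrary restricted partition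
  (\<open>bij_betw_refined_by_units\<close>). The five coefficients count the possible sets of unit parts by
  their number, and that number is determined modulo \<open>3\<close> by the partitioned integer. Hence
  \<open>c (3 k + 3) = c (k + 1) + 3 c k\<close> and \<open>c (3 k + 4) = 3 c (k + 1) + c k\<close>.

  The numbers \<open>m n = (3 ^ n - 3) / 2\<close> satisfy \<open>m (n + 1) = 3 (m n) + 3\<close>, so these two
  recurrences form a closed linear system for the pair \<open>c (m n)\<close>, \<open>c (m n + 1)\<close>. Its matrix, with
  rows \<open>(3, 1)\<close> and \<open>(1, 3)\<close>, has the eigenvalues \<open>4\<close> and \<open>2\<close>: the sum of the pair is
  \<open>4 ^ n\<close> and the difference is \<open>2 ^ n\<close>. Therefore
  \<open>c (m n) = (4 ^ n - 2 ^ n) / 2 = 2 ^ (n - 1) (2 ^ n - 1)\<close>.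

  These are exactly the numbers in the Euclid--Euler theorem, which supplies both statements about
  perfect numbers. Its two directions rest on the fact that for odd \<open>q\<close> the divisor sum of
  \<open>2 ^ k q\<close> is \<open>2 ^ (k + 1) - 1\<close> times that of \<open>q\<close> (\<open>sum_divisors_pow2_times_odd\<close>).
\<close>

section \<open>Stripping the parts of size one\<close>

text \<open>The triple holds the numbers of overlined, tilde and unmarked parts of size \<open>1\<close> that are put
  next to the tripled parts of the given partition.\<close>

definition refined_by_units ::
    "nat \<times> nat \<times> nat \<Rightarrow> (nat \<times> mark) multiset \<Rightarrow> (nat \<times> mark) multiset" where
  "refined_by_units = (\<lambda>(a, b, c) Q.
     replicate_mset a (1, Overlined) + replicate_mset b (1, Tilde) + replicate_mset c (1, Unmarked)
     + image_mset (apfst ((*) 3)) Q)"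

definition restricted_partitions :: "nat \<Rightarrow> (nat \<times> mark) multiset set" where
  "restricted_partitions m = {P. is_restricted_colored_base3_partition P m}"

lemma count_refined_by_units_one:
  "count (refined_by_units (a, b, c) Q) (Suc 0, k)
     = (case k of Overlined \<Rightarrow> a | Tilde \<Rightarrow> b | Unmarked \<Rightarrow> c)"
proof -
  have "(Suc 0, k) \<notin># image_mset (apfst ((*) 3)) Q"
    by auto
  then have "count (image_mset (apfst ((*) 3)) Q) (Suc 0, k) = 0"
    by (simp only: not_in_iff)
  then show ?thesis
    by (cases k) (simp_all add: refined_by_units_def)
qed

lemma count_refined_by_units_triple:
  "count (refined_by_units d Q) (3 * x, k) = count Q (x, k)"
proof -
  have "count (image_mset (apfst ((*) 3)) Q) (3 * x, k) = count Q (x, k)"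
    by (induction Q) auto
  moreover have "3 * x \<noteq> 1"
    by presburger
  ultimately show ?thesis
    by (cases d) (simp add: refined_by_units_def)
qed

text \<open>Nothing is lost: the units are the parts of size \<open>1\<close>, and the tripled parts are never of
  size \<open>1\<close>, so both arguments can be read off from the multiplicities.\<close>

lemma refined_by_units_eq_iff:
  "refined_by_units d Q = refined_by_units d' Q' \<longleftrightarrow> d = d' \<and> Q = Q'"
proof
  assume eq: "refined_by_units d Q = refined_by_units d' Q'"
  obtain a b c a' b' c' where d: "d = (a, b, c)" "d' = (a', b', c')"
    by (metis prod_cases3)
  have "count (refined_by_units (a, b, c) Q) (Suc 0, k)
      = count (refined_by_units (a', b', c') Q') (Suc 0, k)" for k
    using eq d by simp
  from this[of Overlined] this[of Tilde] this[of Unmarked] have "d = d'"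
    by (simp add: count_refined_by_units_one d)
  moreover have "Q = Q'"
  proof (rule multiset_eqI)
    fix p :: "nat \<times> mark"
    show "count Q p = count Q' p"
      using count_refined_by_units_triple[of d Q "fst p" "snd p"]
        count_refined_by_units_triple[of d' Q' "fst p" "snd p"] eq by simp
  qed
  ultimately show "d = d' \<and> Q = Q'" ..
qed simp

text \<open>The conditions on a restricted partition are imposed for each power of \<open>3\<close> separately. Those
  for \<open>3 ^ 0\<close> concern only the units, and those for \<open>3 ^ Suc j\<close> are the conditions for \<open>3 ^ j\<close> on
  the partition before tripling.\<close>

lemma restricted_partition_refined_by_units_iff:
  "is_restricted_colored_base3_partition (refined_by_units (a, b, c) Q) m \<longleftrightarrow>
     a \<le> 1 \<and> b \<le> 1 \<and> c \<le> 2 \<and>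
     (\<exists>k. is_restricted_colored_base3_partition Q k \<and> m = a + b + c + 3 * k)"
proof -
  let ?P = "refined_by_units (a, b, c) Q"
  have sizes: "(\<forall>p \<in># ?P. \<exists>j. fst p = 3 ^ j) \<longleftrightarrow> (\<forall>p \<in># Q. \<exists>j. fst p = 3 ^ j)"
  proof -
    have "(\<exists>j. 3 * x = 3 ^ j) \<longleftrightarrow> (\<exists>j. x = 3 ^ j)" for x :: nat
    proof
      assume "\<exists>j. 3 * x = 3 ^ j"
      then obtain j where j: "3 * x = 3 ^ j" ..
      then show "\<exists>j. x = 3 ^ j"
        by (cases j) auto
    next
      assume "\<exists>j. x = 3 ^ j"
      then show "\<exists>j. 3 * x = 3 ^ j"
        by (metis power_Suc)
    qed
    moreover have "\<exists>j. Suc 0 = 3 ^ j"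
      by (rule exI[of _ 0]) simp
    ultimately show ?thesis
      by (auto simp: refined_by_units_def split: if_splits)
  qed
  have split_j: "(\<forall>j. R j) \<longleftrightarrow> R 0 \<and> (\<forall>j. R (Suc j))" for R :: "nat \<Rightarrow> bool"
    by (metis not0_implies_Suc)
  have multiplicities:
    "(\<forall>j. count ?P (3 ^ j, Overlined) \<le> 1 \<and> count ?P (3 ^ j, Tilde) \<le> 1
          \<and> count ?P (3 ^ j, Unmarked) \<le> 2) \<longleftrightarrow>
     a \<le> 1 \<and> b \<le> 1 \<and> c \<le> 2 \<and>
     (\<forall>j. count Q (3 ^ j, Overlined) \<le> 1 \<and> count Q (3 ^ j, Tilde) \<le> 1
          \<and> count Q (3 ^ j, Unmarked) \<le> 2)"
    by (subst split_j) (simp add: count_refined_by_units_one count_refined_by_units_triple)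
  have total: "(\<Sum>p\<in>#?P. fst p) = a + b + c + 3 * (\<Sum>p\<in>#Q. fst p)"
    by (simp add: refined_by_units_def image_mset.compositionality comp_def sum_mset_distrib_left)
  show ?thesis
    unfolding is_restricted_colored_base3_partition_def sizes multiplicities total by auto
qed

text \<open>A power of \<open>3\<close> other than \<open>1\<close> is divisible by \<open>3\<close>, so all the parts that are not units
  can be divided by \<open>3\<close>.\<close>

lemma restricted_partition_is_refined:
  assumes "is_restricted_colored_base3_partition P m"
  obtains a b c Q where "P = refined_by_units (a, b, c) Q"
proof
  let ?big = "filter_mset (\<lambda>p. fst p \<noteq> 1) P"
  let ?Q = "image_mset (apfst (\<lambda>x. x div 3)) ?big"
  have "apfst ((*) 3) (apfst (\<lambda>x. x div 3) p) = p" if "p \<in># ?big" for p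
  proof -
    from that assms obtain j where "fst p = 3 ^ j" "fst p \<noteq> 1"
      by (auto simp: is_restricted_colored_base3_partition_def)
    then show ?thesis
      by (cases p; cases j) auto
  qed
  then have "image_mset (apfst ((*) 3)) ?Q = image_mset id ?big"
    unfolding image_mset.compositionality comp_def by (intro image_mset_cong) simp
  moreover have "filter_mset (\<lambda>p. fst p = 1) P
      = replicate_mset (count P (1, Overlined)) (1, Overlined)
      + replicate_mset (count P (1, Tilde)) (1, Tilde)
      + replicate_mset (count P (1, Unmarked)) (1, Unmarked)"
  proof (rule multiset_eqI)
    fix p :: "nat \<times> mark"
    show "count (filter_mset (\<lambda>p. fst p = 1) P) p = count
        (replicate_mset (count P (1, Overlined)) (1, Overlined)
        + replicate_mset (count P (1, Tilde)) (1, Tilde)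
        + replicate_mset (count P (1, Unmarked)) (1, Unmarked)) p"
      by (cases p; cases "snd p") auto
  qed
  ultimately show "P = refined_by_units
      (count P (1, Overlined), count P (1, Tilde), count P (1, Unmarked)) ?Q"
    using multiset_partition[of P "\<lambda>p. fst p = 1"] by (simp add: refined_by_units_def)
qed

section \<open>The recurrence for the number of partitions\<close>

text \<open>The admissible numbers of overlined, tilde and unmarked units in a partition of \<open>m\<close>: after
  their removal, a multiple of \<open>3\<close> must remain.\<close>

abbreviation unit_counts :: "nat \<Rightarrow> (nat \<times> nat \<times> nat) set" where
  "unit_counts m \<equiv> {(a, b, c) \<in> {..1} \<times> {..1} \<times> {..2}. \<exists>k. m = a + b + c + 3 * k}"

lemma bij_betw_refined_by_units:
  "bij_betw (\<lambda>(d, Q). refined_by_units d Q)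
     (SIGMA (a, b, c) : unit_counts m. restricted_partitions ((m - (a + b + c)) div 3))
     (restricted_partitions m)"
  unfolding bij_betw_def
proof (intro conjI set_eqI iffI)
  show "inj_on (\<lambda>(d, Q). refined_by_units d Q)
     (SIGMA (a, b, c) : unit_counts m. restricted_partitions ((m - (a + b + c)) div 3))"
    by (auto simp: inj_on_def refined_by_units_eq_iff)
next
  fix P assume "P \<in> (\<lambda>(d, Q). refined_by_units d Q) `
     (SIGMA (a, b, c) : unit_counts m. restricted_partitions ((m - (a + b + c)) div 3))"
  then show "P \<in> restricted_partitions m"
    by (auto simp: restricted_partitions_def restricted_partition_refined_by_units_iff)
next
  fix P assume P: "P \<in> restricted_partitions m"
  then obtain a b c Q where eq: "P = refined_by_units (a, b, c) Q"
    by (auto simp: restricted_partitions_def elim: restricted_partition_is_refined)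
  with P have "((a, b, c), Q) \<in>
     (SIGMA (a, b, c) : unit_counts m. restricted_partitions ((m - (a + b + c)) div 3))"
    by (auto simp: restricted_partitions_def restricted_partition_refined_by_units_iff)
  with eq show "P \<in> (\<lambda>(d, Q). refined_by_units d Q) `
     (SIGMA (a, b, c) : unit_counts m. restricted_partitions ((m - (a + b + c)) div 3))"
    by force
qed

lemma finite_unit_counts: "finite (unit_counts m)"
  by (rule finite_subset[of _ "{..1} \<times> {..1} \<times> {..2}"]) auto

lemma restricted_partitions_0: "restricted_partitions 0 = {{#}}"
proof (intro equalityI subsetI)
  fix P assume "P \<in> restricted_partitions 0"
  then have pow: "\<forall>p \<in># P. \<exists>j. fst p = 3 ^ j" and sum: "(\<Sum>p\<in>#P. fst p) = 0"
    by (auto simp: restricted_partitions_def is_restricted_colored_base3_partition_def)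
  show "P \<in> {{#}}"
  proof (cases P)
    case (add p R)
    with pow sum show ?thesis by auto
  qed simp
qed (simp add: restricted_partitions_def is_restricted_colored_base3_partition_def)

text \<open>Finiteness has to be known before cardinalities can be added up, since \<open>card\<close> is \<open>0\<close> on
  infinite sets. It follows from the same bijection, which leads from \<open>m > 0\<close> to integers of at
  most \<open>m / 3\<close>.\<close>

lemma finite_restricted_partitions: "finite (restricted_partitions m)"
proof (induction m rule: less_induct)
  case (less m)
  show ?case
  proof (cases "m = 0")
    case False
    have "finite (restricted_partitions ((m - s) div 3))" for s
      using False by (intro less.IH) auto
    then have "finite
      (SIGMA (a, b, c) : unit_counts m. restricted_partitions ((m - (a + b + c)) div 3))"
      by (intro finite_SigmaI finite_unit_counts) auto
    then show ?thesis
      using bij_betw_finite[OF bij_betw_refined_by_units] by blast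
  qed (simp add: restricted_partitions_0)
qed

lemma num_restricted_partitions_rec:
  "num_restricted_colored_base3_partitions m =
     (\<Sum>(a, b, c) \<in> unit_counts m. num_restricted_colored_base3_partitions ((m - (a + b + c)) div 3))"
proof -
  have "num_restricted_colored_base3_partitions m = card
      (SIGMA (a, b, c) : unit_counts m. restricted_partitions ((m - (a + b + c)) div 3))"
    using bij_betw_same_card[OF bij_betw_refined_by_units]
    by (simp add: num_restricted_colored_base3_partitions_def restricted_partitions_def)
  also have "\<dots> = (\<Sum>d \<in> unit_counts m.
      card ((\<lambda>(a, b, c). restricted_partitions ((m - (a + b + c)) div 3)) d))"
    by (intro card_SigmaI finite_unit_counts) (auto simp: finite_restricted_partitions)
  finally show ?thesis
    by (simp add: num_restricted_colored_base3_partitions_def restricted_partitions_def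
        case_prod_unfold)
qed

lemma num_restricted_partitions_0: "num_restricted_colored_base3_partitions 0 = 1"
  using restricted_partitions_0
  by (simp add: num_restricted_colored_base3_partitions_def restricted_partitions_def)

lemma num_restricted_partitions_1: "num_restricted_colored_base3_partitions 1 = 3"
proof -
  have "unit_counts 1 = {(1, 0, 0), (0, 1, 0), (0, 0, 1)}"
    by auto
  then show ?thesis
    by (subst num_restricted_partitions_rec) (simp add: num_restricted_partitions_0)
qed

text \<open>At most four units are possible. Here their number is divisible by \<open>3\<close>, so it is \<open>0\<close> (one
  way) or \<open>3\<close> (three ways).\<close>

lemma num_restricted_partitions_triple:
  "num_restricted_colored_base3_partitions (3 * k + 3) =
     num_restricted_colored_base3_partitions (k + 1)
     + 3 * num_restricted_colored_base3_partitions k"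
proof -
  have "unit_counts (3 * k + 3) = {(0, 0, 0), (1, 1, 1), (1, 0, 2), (0, 1, 2)}" (is "?L = ?R")
  proof (rule set_eqI)
    fix d :: "nat \<times> nat \<times> nat"
    obtain a b c where d: "d = (a, b, c)" by (metis prod_cases3)
    have total: "(\<exists>x. 3 * k + 3 = s + 3 * x) \<longleftrightarrow> s = 0 \<or> s = 3" if "s \<le> 4" for s
      using that by presburger
    show "d \<in> ?L \<longleftrightarrow> d \<in> ?R"
    proof (cases "a \<le> 1 \<and> b \<le> 1 \<and> c \<le> 2")
      case True
      then have "(a = 0 \<or> a = 1) \<and> (b = 0 \<or> b = 1) \<and> (c = 0 \<or> c = 1 \<or> c = 2)"
        by linarith
      then show ?thesis
        using total[of "a + b + c"] by (auto simp: d)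
    qed (auto simp: d)
  qed
  then show ?thesis
    by (subst num_restricted_partitions_rec) simp
qed

text \<open>Now the number of units is \<open>1\<close> (three ways) or \<open>4\<close> (one way).\<close>

lemma num_restricted_partitions_triple_plus_1:
  "num_restricted_colored_base3_partitions (3 * k + 4) =
     3 * num_restricted_colored_base3_partitions (k + 1)
     + num_restricted_colored_base3_partitions k"
proof -
  have "unit_counts (3 * k + 4) = {(1, 0, 0), (0, 1, 0), (0, 0, 1), (1, 1, 2)}" (is "?L = ?R")
  proof (rule set_eqI)
    fix d :: "nat \<times> nat \<times> nat"
    obtain a b c where d: "d = (a, b, c)" by (metis prod_cases3)
    have total: "(\<exists>x. 3 * k + 4 = s + 3 * x) \<longleftrightarrow> s = 1 \<or> s = 4" if "s \<le> 4" for s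
      using that by presburger
    show "d \<in> ?L \<longleftrightarrow> d \<in> ?R"
    proof (cases "a \<le> 1 \<and> b \<le> 1 \<and> c \<le> 2")
      case True
      then have "(a = 0 \<or> a = 1) \<and> (b = 0 \<or> b = 1) \<and> (c = 0 \<or> c = 1 \<or> c = 2)"
        by linarith
      then show ?thesis
        using total[of "a + b + c"] by (auto simp: d)
    qed (auto simp: d)
  qed
  moreover have "(3 * k + 4 - 1) div 3 = k + 1"
    by simp
  ultimately show ?thesis
    by (subst num_restricted_partitions_rec) (simp add: algebra_simps)
qed

section \<open>The number of partitions of half of \<open>3 ^ n - 3\<close>\<close>

lemma half_pow3_Suc:
  "(3 ^ Suc (Suc n) - 3) div 2 = 3 * ((3 ^ Suc n - 3) div 2) + (3::nat)"
proof -
  have "odd (3 ^ Suc n :: nat)" "3 ^ Suc n \<ge> (3::nat)"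
    by (simp_all)
  then obtain t where t: "3 ^ Suc n = 2 * t + (3::nat)"
    by (metis add.commute dvd_diffD even_numeral evenE le_Suc_ex odd_add odd_numeral)
  have "3 ^ Suc (Suc n) = 3 * (3 ^ Suc n :: nat)"
    by simp
  then show ?thesis
    unfolding t by simp
qed

text \<open>The recurrences need the value at the successor as well, so both values are carried through
  the induction. The term \<open>2 ^ Suc n\<close> in the first equation is added on the left in order to avoid
  subtraction of natural numbers.\<close>

lemma num_restricted_partitions_half_pow3:
  "2 * num_restricted_colored_base3_partitions ((3 ^ Suc n - 3) div 2) + 2 ^ Suc n = 4 ^ Suc n
   \<and> 2 * num_restricted_colored_base3_partitions ((3 ^ Suc n - 3) div 2 + 1) = 4 ^ Suc n + 2 ^ Suc n"
proof (induction n)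
  case 0
  show ?case
    using num_restricted_partitions_0 num_restricted_partitions_1 by simp
next
  case (Suc n)
  let ?m = "(3 ^ Suc n - 3) div 2 :: nat"
  have "num_restricted_colored_base3_partitions ((3 ^ Suc (Suc n) - 3) div 2) =
      num_restricted_colored_base3_partitions (?m + 1)
      + 3 * num_restricted_colored_base3_partitions ?m"
    unfolding half_pow3_Suc by (rule num_restricted_partitions_triple)
  moreover have "num_restricted_colored_base3_partitions ((3 ^ Suc (Suc n) - 3) div 2 + 1) =
      3 * num_restricted_colored_base3_partitions (?m + 1)
      + num_restricted_colored_base3_partitions ?m"
    using num_restricted_partitions_triple_plus_1[of ?m] unfolding half_pow3_Suc
    by (simp only: add.assoc) simp
  moreover have "(4::nat) ^ Suc (Suc n) = 4 * 4 ^ Suc n" "(2::nat) ^ Suc (Suc n) = 2 * 2 ^ Suc n"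
    by simp_all
  ultimately show ?case
    using Suc.IH by linarith
qed

lemma num_restricted_partitions_closed_form:
  assumes "n \<ge> 1"
  shows "num_restricted_colored_base3_partitions ((3 ^ n - 3) div 2) = 2 ^ (n - 1) * (2 ^ n - 1)"
proof -
  obtain k where n: "n = Suc k"
    using assms by (cases n) auto
  have "(4::nat) ^ n = 2 ^ n * 2 ^ n"
    by (simp flip: power_mult_distrib)
  also have "\<dots> = 2 * (2 ^ k * (2 ^ n - 1)) + 2 ^ n"
    by (simp add: n algebra_simps)
  finally show ?thesis
    using num_restricted_partitions_half_pow3[of k] by (simp add: n)
qed

section \<open>The Euclid--Euler theorem\<close>

lemma sum_divisors_eq_proper_plus_self:
  fixes N :: nat
  assumes "N > 0"
  shows "\<Sum>{d. d dvd N} = \<Sum>{d. d dvd N \<and> d < N} + N"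
proof -
  have "{d. d dvd N} = insert N {d. d dvd N \<and> d < N}"
    using assms by (auto dest: dvd_imp_le)
  then show ?thesis
    by (simp add: add.commute)
qed

lemma perfect_number_iff_sum_divisors:
  "perfect_number N \<longleftrightarrow> N > 0 \<and> \<Sum>{d. d dvd N} = 2 * N"
  using sum_divisors_eq_proper_plus_self[of N] by (auto simp: perfect_number_def)

text \<open>The odd divisors of \<open>2 ^ Suc k * q\<close> are the divisors of \<open>q\<close>, and the even ones are twice
  the divisors of \<open>2 ^ k * q\<close>. So the divisor sums \<open>s k\<close> satisfy \<open>s (k + 1) = s 0 + 2 * s k\<close>.\<close>

lemma sum_divisors_pow2_times_odd:
  fixes q :: nat
  assumes "odd q"
  shows "\<Sum>{d. d dvd 2 ^ k * q} = (2 ^ Suc k - 1) * \<Sum>{d. d dvd q}"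
proof (induction k)
  case 0
  show ?case by simp
next
  case (Suc k)
  have split: "{d. d dvd 2 ^ Suc k * q} = {d. d dvd q} \<union> (*) 2 ` {d. d dvd 2 ^ k * q}"
  proof (intro set_eqI)
    fix d :: nat
    show "d \<in> {d. d dvd 2 ^ Suc k * q} \<longleftrightarrow> d \<in> {d. d dvd q} \<union> (*) 2 ` {d. d dvd 2 ^ k * q}"
    proof (cases "even d")
      case True
      then have "\<not> d dvd q"
        using assms dvd_trans by blast
      with True show ?thesis
        by (auto simp: mult.assoc elim!: evenE)
    next
      case False
      then have "coprime d (2 ^ Suc k)"
        by simp
      then have "d dvd 2 ^ Suc k * q \<longleftrightarrow> d dvd q"
        by (rule coprime_dvd_mult_right_iff)
      with False show ?thesis
        by auto
    qed
  qed
  have "q > 0"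
    using assms by (rule odd_pos)
  have "\<Sum>{d. d dvd 2 ^ Suc k * q} = \<Sum>{d. d dvd q} + \<Sum>((*) 2 ` {d. d dvd 2 ^ k * q})"
    unfolding split using assms \<open>q > 0\<close> by (intro sum.union_disjoint) auto
  also have "\<Sum>((*) 2 ` {d. d dvd 2 ^ k * q}) = 2 * \<Sum>{d. d dvd 2 ^ k * q}"
    by (subst sum.reindex) (auto simp: inj_on_def sum_distrib_left)
  finally have "\<Sum>{d. d dvd 2 ^ Suc k * q} = (1 + 2 * (2 ^ Suc k - 1)) * \<Sum>{d. d dvd q}"
    unfolding Suc.IH by (simp only: distrib_right mult_1 mult.assoc)
  moreover have "1 + 2 * (2 ^ Suc k - 1) = 2 ^ Suc (Suc k) - (1::nat)"
    using one_le_power[of "2::nat" "Suc k"] by (simp only: power_Suc) linarith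
  ultimately show ?case
    by (simp only:)
qed

text \<open>A prime \<open>p = 2 ^ n - 1\<close> has divisor sum \<open>p + 1 = 2 ^ n\<close>, and \<open>2 ^ (n - 1)\<close> has divisor sum
  \<open>p\<close>; the product \<open>2 ^ n * p\<close> is twice the number in question.\<close>

lemma euclid_perfect_number:
  assumes "prime (2 ^ n - 1 :: nat)"
  shows "perfect_number (2 ^ (n - 1) * (2 ^ n - 1))"
proof -
  let ?p = "2 ^ n - 1 :: nat"
  have "n \<noteq> 0"
    using assms by (intro notI) simp
  then obtain k where n: "n = Suc k"
    by (cases n) auto
  have "odd ?p"
    using n by simp
  have "{d. d dvd ?p} = {1, ?p}"
    using assms by (auto simp: prime_nat_iff)
  moreover have "?p \<noteq> 1"
    using assms by (metis not_prime_1)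
  ultimately have "\<Sum>{d. d dvd ?p} = 2 ^ n"
    by simp
  then have "\<Sum>{d. d dvd 2 ^ k * ?p} = 2 * (2 ^ k * ?p)"
    using sum_divisors_pow2_times_odd[OF \<open>odd ?p\<close>, of k] n by simp
  moreover have "?p > 0"
    using assms by (rule prime_gt_0_nat)
  ultimately show ?thesis
    using n by (simp add: perfect_number_iff_sum_divisors)
qed

text \<open>If \<open>a\<close> divides \<open>n\<close> then \<open>2 ^ a - 1\<close> divides \<open>2 ^ n - 1\<close>, by the geometric sum.\<close>

lemma prime_exponent_of_mersenne_prime:
  assumes "prime (2 ^ n - 1 :: nat)"
  shows "prime n"
  unfolding prime_nat_iff
proof (intro conjI allI impI)
  show "n > 1"
  proof (rule ccontr)
    assume "\<not> n > 1"
    then have "n = 0 \<or> n = 1" by auto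
    with assms show False by auto
  qed
  fix a assume "a dvd n"
  then obtain b where b: "n = a * b" ..
  have "(2 ^ a - 1 :: int) dvd (2 ^ a) ^ b - 1"
    unfolding power_diff_1_eq by (rule dvd_triv_left)
  then have "int (2 ^ a - 1) dvd int (2 ^ n - 1)"
    by (simp add: b power_mult of_nat_diff)
  then have "(2 ^ a - 1 :: nat) dvd 2 ^ n - 1"
    by (simp only: of_nat_dvd_iff)
  then have "2 ^ a - 1 = (1::nat) \<or> 2 ^ a - 1 = (2 ^ n - 1 :: nat)"
    using assms by (auto simp: prime_nat_iff)
  then have "(2::nat) ^ a = 2 ^ 1 \<or> (2::nat) ^ a = 2 ^ n"
    using one_le_power[of "2::nat" a] one_le_power[of "2::nat" n]
    by (simp only: power_one_right) linarith
  then show "a = 1 \<or> a = n"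
    by (simp only: power_inject_exp)
qed

text \<open>Write \<open>N = 2 ^ k * q\<close> with \<open>q\<close> odd and put \<open>M = 2 ^ Suc k - 1\<close>. Perfection says that \<open>M\<close>
  times the divisor sum of \<open>q\<close> is \<open>(M + 1) * q\<close>, so \<open>q = M * r\<close> for some \<open>r\<close>, and the divisor sum
  of \<open>q\<close> is \<open>q + r\<close>. As \<open>q\<close> and \<open>r\<close> are already two divisors with this sum, there are no others;
  since \<open>1\<close> is a divisor, \<open>r = 1\<close> and \<open>q = M\<close> is prime.\<close>

lemma euler_even_perfect_number:
  assumes "even N" and "perfect_number N"
  obtains n where "prime (2 ^ n - 1 :: nat)" and "N = 2 ^ (n - 1) * (2 ^ n - 1)"
proof -
  have "N > 0" and sigma: "\<Sum>{d. d dvd N} = 2 * N"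
    using assms(2) by (auto simp: perfect_number_iff_sum_divisors)
  obtain q where q: "N = 2 ^ multiplicity 2 N * q" and "odd q"
    using \<open>N > 0\<close> by (auto intro: multiplicity_decompose'[of N 2])
  then obtain k where N: "N = 2 ^ k * q"
    by blast
  have "k > 0"
    using assms(1) N \<open>odd q\<close> by (cases k) auto
  define M where "M = (2 ^ Suc k - 1 :: nat)"
  have M: "2 ^ Suc k = Suc M"
    by (simp add: M_def)
  \<comment> \<open>This is where evenness matters: for \<open>k = 0\<close> the divisors \<open>q\<close> and \<open>r\<close> would coincide.\<close>
  have "M \<ge> 3"
    using \<open>k > 0\<close> power_increasing[of 2 "Suc k" "2::nat"] by (simp add: M_def)
  have eq: "M * \<Sum>{d. d dvd q} = Suc M * q"
    using sum_divisors_pow2_times_odd[OF \<open>odd q\<close>, of k] sigma unfolding N M[symmetric] M_def by simp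
  then have "M dvd Suc M * q"
    by (metis dvd_triv_left)
  then have "M dvd q"
    by (simp add: dvd_add_left_iff)
  then obtain r where r: "q = M * r" ..
  have "M * \<Sum>{d. d dvd q} = M * (q + r)"
    using eq unfolding r by (simp add: algebra_simps)
  then have sigma_q: "\<Sum>{d. d dvd q} = q + r"
    using \<open>M \<ge> 3\<close> by simp
  have "q > 0"
    using \<open>odd q\<close> by (rule odd_pos)
  then have "r > 0" "r < q"
    using r \<open>M \<ge> 3\<close> by auto
  have only: "d = q \<or> d = r" if "d dvd q" for d
  proof (rule ccontr)
    assume "\<not> (d = q \<or> d = r)"
    then have "\<Sum>{d, q, r} = d + q + r"
      using \<open>r < q\<close> by simp
    moreover have "\<Sum>{d, q, r} \<le> \<Sum>{d. d dvd q}"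
      using that r \<open>q > 0\<close> by (intro sum_mono2) auto
    moreover have "d > 0"
      using that \<open>q > 0\<close> by (rule dvd_pos_nat[rotated])
    ultimately show False
      using sigma_q by simp
  qed
  from only[of 1] have "r = 1"
    using \<open>r > 0\<close> \<open>r < q\<close> by auto
  with r only \<open>M \<ge> 3\<close> have "prime M"
    by (auto simp: prime_nat_iff)
  with that[of "Suc k"] show ?thesis
    using N r \<open>r = 1\<close> by (simp add: M_def)
qed

section \<open>Perfect numbers as numbers of partitions\<close>

theorem corollary3p2:
  shows "(\<forall>n::nat. n \<ge> 1 \<longrightarrow>
            num_restricted_colored_base3_partitions ((3 ^ n - 3) div 2) = 2 ^ (n - 1) * (2 ^ n - 1)) \<and>
         (\<forall>n::nat. prime n \<and> prime (2 ^ n - 1 :: nat) \<longrightarrow>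
            perfect_number (num_restricted_colored_base3_partitions ((3 ^ n - 3) div 2))) \<and>
         (\<forall>N::nat. even N \<and> perfect_number N \<longrightarrow>
            (\<exists>n::nat. prime n \<and> prime (2 ^ n - 1 :: nat) \<and>
               N = num_restricted_colored_base3_partitions ((3 ^ n - 3) div 2)))"
proof (intro conjI allI impI)
  fix n :: nat
  assume "n \<ge> 1"
  then show "num_restricted_colored_base3_partitions ((3 ^ n - 3) div 2) = 2 ^ (n - 1) * (2 ^ n - 1)"
    by (rule num_restricted_partitions_closed_form)
next
  fix n :: nat
  assume n: "prime n \<and> prime (2 ^ n - 1 :: nat)"
  then show "perfect_number (num_restricted_colored_base3_partitions ((3 ^ n - 3) div 2))"
    using euclid_perfect_number[of n] num_restricted_partitions_closed_form[of n] prime_ge_1_nat[of n]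
    by simp
next
  fix N :: nat
  assume "even N \<and> perfect_number N"
  then obtain n where n: "prime (2 ^ n - 1 :: nat)" and N: "N = 2 ^ (n - 1) * (2 ^ n - 1)"
    by (elim conjE) (rule euler_even_perfect_number)
  from n have "prime n"
    by (rule prime_exponent_of_mersenne_prime)
  have "N = num_restricted_colored_base3_partitions ((3 ^ n - 3) div 2)"
    unfolding N
    by (rule num_restricted_partitions_closed_form[OF prime_ge_1_nat[OF \<open>prime n\<close>], symmetric])
  with n \<open>prime n\<close> show "\<exists>n::nat. prime n \<and> prime (2 ^ n - 1 :: nat) \<and>
      N = num_restricted_colored_base3_partitions ((3 ^ n - 3) div 2)"
    by (intro exI[of _ n] conjI)
qed

end
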